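(* Let $\theta,\theta'\in\mathbb{R}$ and let $$|\mathrm{Pmee}\rangle_{AB}=|00\rangle_{AB},\qquad |\mathrm{pMee}\rangle_{AB}=\frac{1}{\sqrt{2}}\left(e^{i\theta}|01\rangle_{AB}+e^{i\theta'}|10\rangle_{AB}\right).$$ The pairs of entangled states completing these two states to an orthonormal basis of $\mathbb{C}^2\otimes\mathbb{C}^2$ are, up to global phases, exactly the pairs characterized by a real number $\theta''$ and a complex number $c$ with $0<|c|<1/\sqrt{2}$ through the Schmidt decompositions $$|\mathrm{pmEe}\rangle_{AB}=\sum_{j=0}^1\xi_j\left(\frac{|x_j\rangle_A}{\||x_j\rangle\|}\right)\otimes\left(\frac{|y_j^*\rangle_B}{\||y_j\rangle\|}\right),\qquad |\mathrm{pmeE}\rangle_{AB}=\sum_{j=0}^1\upsilon_j\left(\frac{|z_j\rangle_A}{\||z_j\rangle\|}\right)\otimes\left(\frac{|w_j^*\rangle_B}{\||w_j\rangle\|}\right),$$ where $$\xi_j=\left(\frac{1+(-1)^j\sqrt{1-4|c|^4}}{2}\right)^{1/2},\qquad \upsilon_j=\left(\frac{1+(-1)^j2|c|\sqrt{1-|c|^2}}{2}\right)^{1/2},$$ $$|x_j\rangle=\begin{bmatrix}(-1)^jc \\ e^{i\theta''}\xi_j\end{bmatrix},\qquad |y_j^*\rangle=\begin{bmatrix}-e^{-i(\theta-\theta'+\theta'')}c \\ (-1)^j\xi_j\end{bmatrix},$$ $$|z_j\rangle=\begin{bmatrix}(-1)^je^{-i\theta''}\sqrt{\upsilon_0\upsilon_1}\,|c|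 \\ -c^*\upsilon_j\end{bmatrix},\qquad |w_j^*\rangle=\begin{bmatrix}e^{-i(\theta-\theta'+\theta'')}\sqrt{\upsilon_0\upsilon_1}\,c \\ (-1)^j|c|\upsilon_j\end{bmatrix}.$$
   Context: $|0\rangle,|1\rangle$ is the standard basis of $\mathbb{C}^2$, $|jk\rangle_{AB}=|j\rangle_A\otimes|k\rangle_B$, column vectors are with respect to the standard basis, $^*$ on scalars is complex conjugation, and $|y^*\rangle$ is the entrywise complex conjugate of $|y\rangle$ (so $\||y^*\rangle\|=\||y\rangle\|$). A state is a unit vector; a state in $\mathbb{C}^2\otimes\mathbb{C}^2$ is a product state if it equals $|u\rangle\otimes|v\rangle$, and entangled otherwise. A Schmidt decomposition of a state is an expression $\sum_j\lambda_j|u_j\rangle\otimes|v_j\rangle$ with $\lambda_j\ge 0$ (the Schmidt coefficients) and $\{|u_j\rangle\}$, $\{|v_j\rangle\}$ orthonormal families in $\mathbb{C}^2$. "Up to global phases" means each state may be multiplied by a complex number of modulus one. *)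

theory Defs
  imports "HOL-Analysis.Analysis"
begin

(* The index type 2 labels the standard basis of the qubit space: index 1 is ket 0 and
   index 2 is ket 1.  The space of two qubits has the pairs of such indices as coordinates. *)
type_synonym qubit = "complex ^ 2"
type_synonym two_qubits = "complex ^ (2 \<times> 2)"

definition ket0 :: qubit where "ket0 = axis 1 1"
definition ket1 :: qubit where "ket1 = axis 2 1"

definition tensor :: "qubit \<Rightarrow> qubit \<Rightarrow> two_qubits" (infixr "\<otimes>\<^sub>q" 75) where
  "u \<otimes>\<^sub>q v = (\<chi> p. u $ fst p * v $ snd p)"

definition vcnj :: "complex ^ 'n \<Rightarrow> complex ^ 'n" where
  "vcnj v = (\<chi> i. cnj (v $ i))"

(* The library's inner product on complex ^ 'n is the real one, so the Hermitian one is
   introduced here; it is conjugate-linear in the first argument. *)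
definition hinner :: "complex ^ 'n \<Rightarrow> complex ^ 'n \<Rightarrow> complex" where
  "hinner u v = (\<Sum>i\<in>UNIV. cnj (u $ i) * v $ i)"

definition orthonormal_family :: "'i set \<Rightarrow> ('i \<Rightarrow> complex ^ 'n) \<Rightarrow> bool" where
  "orthonormal_family I f \<longleftrightarrow> (\<forall>i\<in>I. \<forall>j\<in>I. hinner (f i) (f j) = (if i = j then 1 else 0))"

(* vec.span is the span over the complex numbers, as opposed to the real span. *)
definition orthonormal_basis :: "(complex ^ 'n) list \<Rightarrow> bool" where
  "orthonormal_basis vs \<longleftrightarrow>
     orthonormal_family {..<length vs} (\<lambda>k. vs ! k) \<and> vec.span (set vs) = UNIV"

definition state :: "complex ^ 'n \<Rightarrow> bool" where
  "state s \<longleftrightarrow> norm s = 1"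

definition product_state :: "two_qubits \<Rightarrow> bool" where
  "product_state s \<longleftrightarrow> state s \<and> (\<exists>u v. s = u \<otimes>\<^sub>q v)"

definition entangled :: "two_qubits \<Rightarrow> bool" where
  "entangled s \<longleftrightarrow> state s \<and> \<not> product_state s"

definition schmidt_decomposition ::
  "two_qubits \<Rightarrow> 'i set \<Rightarrow> ('i \<Rightarrow> real) \<Rightarrow> ('i \<Rightarrow> qubit) \<Rightarrow> ('i \<Rightarrow> qubit) \<Rightarrow> bool" where
  "schmidt_decomposition s J l u v \<longleftrightarrow>
     state s \<and> finite J \<and> (\<forall>j\<in>J. l j \<ge> 0) \<and> orthonormal_family J u \<and> orthonormal_family J v \<and>
     s = (\<Sum>j\<in>J. l j *\<^sub>R (u j \<otimes>\<^sub>q v j))"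

definition eq_up_to_phase :: "complex ^ 'n \<Rightarrow> complex ^ 'n \<Rightarrow> bool" where
  "eq_up_to_phase s t \<longleftrightarrow> (\<exists>a. cmod a = 1 \<and> s = a *s t)"

definition Pmee :: two_qubits where
  "Pmee = ket0 \<otimes>\<^sub>q ket0"

definition pMee :: "real \<Rightarrow> real \<Rightarrow> two_qubits" where
  "pMee \<theta> \<theta>' = (1 / complex_of_real (sqrt 2)) *s
     (cis \<theta> *s (ket0 \<otimes>\<^sub>q ket1) + cis \<theta>' *s (ket1 \<otimes>\<^sub>q ket0))"

definition xi :: "complex \<Rightarrow> nat \<Rightarrow> real" where
  "xi c j = sqrt ((1 + (- 1) ^ j * sqrt (1 - 4 * cmod c ^ 4)) / 2)"

definition upsilon :: "complex \<Rightarrow> nat \<Rightarrow> real" where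
  "upsilon c j = sqrt ((1 + (- 1) ^ j * 2 * cmod c * sqrt (1 - (cmod c)\<^sup>2)) / 2)"

definition x_vec :: "real \<Rightarrow> complex \<Rightarrow> nat \<Rightarrow> qubit" where
  "x_vec \<theta>'' c j = vector [(- 1) ^ j * c, cis \<theta>'' * complex_of_real (xi c j)]"

(* The columns given for the second tensor factor are the entrywise conjugates of y and w,
   so conjugating them gives y and w themselves. *)
definition y_vec :: "real \<Rightarrow> real \<Rightarrow> real \<Rightarrow> complex \<Rightarrow> nat \<Rightarrow> qubit" where
  "y_vec \<theta> \<theta>' \<theta>'' c j =
     vcnj (vector [- cis (- (\<theta> - \<theta>' + \<theta>'')) * c, (- 1) ^ j * complex_of_real (xi c j)])"

definition z_vec :: "real \<Rightarrow> complex \<Rightarrow> nat \<Rightarrow> qubit" where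
  "z_vec \<theta>'' c j = vector
     [(- 1) ^ j * cis (- \<theta>'') * complex_of_real (sqrt (upsilon c 0 * upsilon c 1) * cmod c),
      - cnj c * complex_of_real (upsilon c j)]"

definition w_vec :: "real \<Rightarrow> real \<Rightarrow> real \<Rightarrow> complex \<Rightarrow> nat \<Rightarrow> qubit" where
  "w_vec \<theta> \<theta>' \<theta>'' c j = vcnj (vector
     [cis (- (\<theta> - \<theta>' + \<theta>'')) * complex_of_real (sqrt (upsilon c 0 * upsilon c 1)) * c,
      (- 1) ^ j * complex_of_real (cmod c * upsilon c j)])"

definition pmEe :: "real \<Rightarrow> real \<Rightarrow> real \<Rightarrow> complex \<Rightarrow> two_qubits" where
  "pmEe \<theta> \<theta>' \<theta>'' c = (\<Sum>j = 0..1. xi c j *\<^sub>R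
     ((x_vec \<theta>'' c j /\<^sub>R norm (x_vec \<theta>'' c j)) \<otimes>\<^sub>q
      (vcnj (y_vec \<theta> \<theta>' \<theta>'' c j) /\<^sub>R norm (y_vec \<theta> \<theta>' \<theta>'' c j))))"

definition pmeE :: "real \<Rightarrow> real \<Rightarrow> real \<Rightarrow> complex \<Rightarrow> two_qubits" where
  "pmeE \<theta> \<theta>' \<theta>'' c = (\<Sum>j = 0..1. upsilon c j *\<^sub>R
     ((z_vec \<theta>'' c j /\<^sub>R norm (z_vec \<theta>'' c j)) \<otimes>\<^sub>q
      (vcnj (w_vec \<theta> \<theta>' \<theta>'' c j) /\<^sub>R norm (w_vec \<theta> \<theta>' \<theta>'' c j))))"

end

theory Submission
  imports Defs
begin

text \<open>
  Written as a coefficient matrix, a vector orthogonal to the two given states has the form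
  \<open>[[0, b], [-exp (i (\<theta>' - \<theta>)) b, d]]\<close>, and it is entangled iff \<open>b\<close> is nonzero.  A unit vector of
  this form satisfies \<open>2 |b|^2 + |d|^2 = 1\<close>, and its companion is determined up to a phase;
  the companion is entangled iff \<open>d\<close> is nonzero.  The parameters are \<open>c = b\<close> and \<open>\<theta>'' = arg d\<close>.
  The Schmidt bases are recognised through the identities \<open>\<xi>\<^sub>0\<^sup>2 + \<xi>\<^sub>1\<^sup>2 = 1\<close>, \<open>\<xi>\<^sub>0 \<xi>\<^sub>1 = |c|\<^sup>2\<close> and
  \<open>\<upsilon>\<^sub>0\<^sup>2 + \<upsilon>\<^sub>1\<^sup>2 = 1\<close>, \<open>\<upsilon>\<^sub>0 \<upsilon>\<^sub>1 = (1 - 2 |c|\<^sup>2) / 2\<close>.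
\<close>

subsection \<open>The Hermitian inner product\<close>

lemma hinner_self: "hinner u u = complex_of_real ((norm u)\<^sup>2)"
proof -
  have "(norm u)\<^sup>2 = (\<Sum>i\<in>UNIV. (cmod (u $ i))\<^sup>2)"
    by (simp add: norm_vec_def L2_set_def sum_nonneg)
  thus ?thesis
    by (simp add: hinner_def complex_norm_square mult.commute del: of_real_power)
qed

lemma hinner_scaleR: "hinner (r *\<^sub>R u) (t *\<^sub>R v) = complex_of_real (r * t) * hinner u v"
  unfolding hinner_def sum_distrib_left
  by (rule sum.cong) (auto simp: scaleR_conv_of_real[where ?'a = complex])

lemma hinner_mult: "hinner (a *s u) (b *s v) = cnj a * b * hinner u v"
  unfolding hinner_def sum_distrib_left
  by (rule sum.cong) auto

lemma hinner_commute: "hinner v u = cnj (hinner u v)"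
  by (simp add: hinner_def mult.commute)

lemma hinner_sum_right: "hinner u (\<Sum>x\<in>A. f x) = (\<Sum>x\<in>A. hinner u (f x))"
  unfolding hinner_def sum_component sum_distrib_left by (rule sum.swap)

lemma hinner_mult_right: "hinner u (b *s v) = b * hinner u v"
  using hinner_mult[of 1 u b v] by (simp add: vector_smult_lid)

section \<open>Orthonormal lists and bases\<close>

lemma orthonormal_family_independent:
  fixes vs :: "(complex ^ 'n) list"
  assumes "orthonormal_family {..<length vs} (\<lambda>k. vs ! k)"
  shows "vec.independent (set vs)" "distinct vs"
proof -
  have on: "hinner (vs ! i) (vs ! j) = (if i = j then 1 else 0)"
    if "i < length vs" "j < length vs" for i j
    using assms that by (auto simp: orthonormal_family_def)
  show "distinct vs"
    unfolding distinct_conv_nth using on by (metis zero_neq_one)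
  show "vec.independent (set vs)"
    unfolding vec.independent_explicit_finite_subsets
  proof (intro allI impI ballI)
    fix S u v
    assume S: "S \<subseteq> set vs" "finite S" "(\<Sum>v\<in>S. u v *s v) = 0" and v: "v \<in> S"
    have o: "hinner v w = (if w = v then 1 else 0)" if "w \<in> S" for w
    proof -
      have "v \<in> set vs" "w \<in> set vs"
        using S(1) v \<open>w \<in> S\<close> by auto
      then obtain i j where "i < length vs" "v = vs ! i" "j < length vs" "w = vs ! j"
        by (auto simp: in_set_conv_nth)
      thus ?thesis
        using on[of i i] on[of i j] by auto
    qed
    \<comment> \<open>Pairing the vanishing combination with \<open>v\<close> isolates the
      coefficient \<open>u v\<close>.\<close>
    have "0 = hinner v (\<Sum>w\<in>S. u w *s w)"
      using S by (simp add: hinner_def)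
    also have "\<dots> = (\<Sum>w\<in>S. if w = v then u w else 0)"
      unfolding hinner_sum_right hinner_mult_right by (rule sum.cong) (simp_all add: o)
    finally show "u v = 0"
      using S v by simp
  qed
qed

text \<open>As many independent vectors as the dimension must span, so completeness of a basis
  reduces to inner products and a count.\<close>

lemma orthonormal_family_imp_basis:
  fixes vs :: "(complex ^ 'n) list"
  assumes "orthonormal_family {..<length vs} (\<lambda>k. vs ! k)" "length vs = CARD('n)"
  shows "orthonormal_basis vs"
proof -
  have "UNIV \<subseteq> vec.span (set vs)"
    by (rule vec.card_ge_dim_independent)
      (use assms orthonormal_family_independent[OF assms(1)] in
        \<open>auto simp: distinct_card card_cart_basis vec.dim_UNIV\<close>)
  thus ?thesis
    using assms by (auto simp: orthonormal_basis_def)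
qed

subsection \<open>Two-qubit vectors as coefficient matrices\<close>

lemma sum_UNIV_2_2: "sum f (UNIV :: (2 \<times> 2) set) = f (1, 1) + f (1, 2) + f (2, 1) + f (2, 2)"
proof -
  have "sum f (UNIV :: (2 \<times> 2) set) = (\<Sum>i\<in>UNIV. \<Sum>j\<in>UNIV. f (i, j))"
    by (simp add: sum.cartesian_product flip: UNIV_Times_UNIV)
  thus ?thesis
    by (simp add: sum_2 add.assoc)
qed

lemma two_qubits_eq_iff: "s = t \<longleftrightarrow>
    s $ (1, 1) = t $ (1, 1) \<and> s $ (1, 2) = t $ (1, 2) \<and> s $ (2, 1) = t $ (2, 1) \<and>
    s $ (2, 2) = t $ (2, 2)" for s t :: two_qubits
  by (auto simp: vec_eq_iff forall_2)

text \<open>The coefficient matrix [[a, b], [c, d]], with rows indexed by the first qubit; tensor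
  products are then the matrices of rank at most one.\<close>

definition amplitudes :: "complex \<Rightarrow> complex \<Rightarrow> complex \<Rightarrow> complex \<Rightarrow> two_qubits" where
  "amplitudes a b c d = (\<chi> p. if p = (1, 1) then a else if p = (1, 2) then b
     else if p = (2, 1) then c else d)"

lemma amplitudes_nth [simp]:
  "amplitudes a b c d $ (1, 1) = a" "amplitudes a b c d $ (1, 2) = b"
  "amplitudes a b c d $ (2, 1) = c" "amplitudes a b c d $ (2, 2) = d"
  by (simp_all add: amplitudes_def)

lemma amplitudes_cases:
  obtains a b c d where "s = amplitudes a b c d"
proof
  show "s = amplitudes (s $ (1, 1)) (s $ (1, 2)) (s $ (2, 1)) (s $ (2, 2))"
    by (simp add: two_qubits_eq_iff)
qed

lemma amplitudes_eq_iff: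
  "amplitudes a b c d = amplitudes a' b' c' d' \<longleftrightarrow> a = a' \<and> b = b' \<and> c = c' \<and> d = d'"
  by (simp add: two_qubits_eq_iff)

lemma amplitudes_smult: "k *s amplitudes a b c d = amplitudes (k * a) (k * b) (k * c) (k * d)"
  by (simp add: two_qubits_eq_iff)

lemma tensor_eq_amplitudes:
  "u \<otimes>\<^sub>q v = amplitudes (u $ 1 * v $ 1) (u $ 1 * v $ 2) (u $ 2 * v $ 1) (u $ 2 * v $ 2)"
  by (simp add: two_qubits_eq_iff tensor_def)

lemma hinner_amplitudes: "hinner (amplitudes a b c d) (amplitudes a' b' c' d') =
    cnj a * a' + cnj b * b' + cnj c * c' + cnj d * d'"
  by (simp add: hinner_def sum_UNIV_2_2)

lemma state_amplitudes:
  "state (amplitudes a b c d) \<longleftrightarrow> (cmod a)\<^sup>2 + (cmod b)\<^sup>2 + (cmod c)\<^sup>2 + (cmod d)\<^sup>2 = 1"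
  by (simp add: state_def norm_vec_def L2_set_def sum_UNIV_2_2)

lemma state_iff_hinner: "state s \<longleftrightarrow> hinner s s = 1"
proof -
  have "(norm s)\<^sup>2 = 1 \<longleftrightarrow> norm s = 1"
    using norm_ge_zero[of s] by (auto simp: power2_eq_1_iff simp del: norm_ge_zero)
  thus ?thesis
    unfolding state_def hinner_self of_real_eq_1_iff by simp
qed

text \<open>With a zero upper-left entry the determinant is \<open>- b * c\<close>, and a tensor
  product has determinant zero. Conversely, \<open>b = 0\<close> leaves only the second row and
  \<open>c = 0\<close> only the second column, so the factors can be written down.\<close>

lemma entangled_amplitudes:
  "entangled (amplitudes 0 b c d) \<longleftrightarrow> state (amplitudes 0 b c d) \<and> b \<noteq> 0 \<and> c \<noteq> 0"
proof -
  have "(\<exists>u v. amplitudes 0 b c d = u \<otimes>\<^sub>q v) \<longleftrightarrow> b = 0 \<or> c = 0"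
  proof
    assume "\<exists>u v. amplitudes 0 b c d = u \<otimes>\<^sub>q v"
    thus "b = 0 \<or> c = 0"
      by (auto simp: tensor_eq_amplitudes amplitudes_eq_iff)
  next
    assume "b = 0 \<or> c = 0"
    thus "\<exists>u v. amplitudes 0 b c d = u \<otimes>\<^sub>q v"
    proof
      assume "b = 0"
      hence "amplitudes 0 b c d = vector [0, 1] \<otimes>\<^sub>q vector [c, d]"
        by (simp add: tensor_eq_amplitudes amplitudes_eq_iff vector_2)
      thus ?thesis by blast
    next
      assume "c = 0"
      hence "amplitudes 0 b c d = vector [b, d] \<otimes>\<^sub>q vector [0, 1]"
        by (simp add: tensor_eq_amplitudes amplitudes_eq_iff vector_2)
      thus ?thesis by blast
    qed
  qed
  thus ?thesis
    by (auto simp: entangled_def product_state_def)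
qed

lemma Pmee_eq_amplitudes: "Pmee = amplitudes 1 0 0 0"
  by (simp add: Pmee_def ket0_def tensor_eq_amplitudes amplitudes_eq_iff axis_def)

lemma pMee_eq_amplitudes: "pMee \<theta> \<theta>' = amplitudes 0 (cis \<theta> / sqrt 2) (cis \<theta>' / sqrt 2) 0"
  by (simp add: pMee_def ket0_def ket1_def tensor_eq_amplitudes two_qubits_eq_iff axis_def)

lemma vcnj_vcnj [simp]: "vcnj (vcnj v) = v"
  by (simp add: vcnj_def vec_eq_iff)

lemma norm_vcnj [simp]: "norm (vcnj v) = norm v"
  by (simp add: vcnj_def norm_vec_def)

subsection \<open>The Schmidt decompositions\<close>

context
  fixes a b e f :: complex and K :: real and s :: "nat \<Rightarrow> real" and u v :: "nat \<Rightarrow> qubit"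
  assumes K: "0 < K" "cmod b = K" "cmod f = K"
    and s: "0 < s 0" "0 < s 1" "(s 0)\<^sup>2 + (s 1)\<^sup>2 = 1"
    and ae: "(cmod a)\<^sup>2 = s 0 * s 1 * K\<^sup>2" "(cmod e)\<^sup>2 = s 0 * s 1 * K\<^sup>2"
    and u: "\<And>j. u j = vector [(- 1) ^ j * a, b * s j]"
    and v: "\<And>j. v j = vector [e, (- 1) ^ j * f * s j]"
begin

text \<open>The assumption on \<open>a\<close> and \<open>e\<close> turns both squared norms into
  K^2 (s_0 s_1 + s_j^2), which factors with \<open>s j\<close> split off.\<close>

lemma schmidt_norm:
  assumes "j \<in> {0..1}"
  shows "(norm (u j))\<^sup>2 = K\<^sup>2 * s j * (s 0 + s 1)" "norm (v j) = norm (u j)" "0 < norm (u j)"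
proof -
  have j: "j = 0 \<or> j = 1" using assms by auto
  have u': "(norm (u j))\<^sup>2 = K\<^sup>2 * s j * (s 0 + s 1)"
    using j K ae s by (auto simp: u norm_vec_def L2_set_def sum_2 vector_2 norm_mult norm_power
        power_mult_distrib algebra_simps power2_eq_square)
  have v': "(norm (v j))\<^sup>2 = K\<^sup>2 * s j * (s 0 + s 1)"
    using j K ae s by (auto simp: v norm_vec_def L2_set_def sum_2 vector_2 norm_mult norm_power
        power_mult_distrib algebra_simps power2_eq_square)
  show "(norm (u j))\<^sup>2 = K\<^sup>2 * s j * (s 0 + s 1)" by fact
  show "norm (v j) = norm (u j)"
    using u' v' by (metis norm_ge_zero power2_eq_imp_eq)
  have "0 < (norm (u j))\<^sup>2"
    unfolding u' using j K s by auto
  thus "0 < norm (u j)"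
    by (metis norm_ge_zero less_eq_real_def zero_less_power2)
qed

text \<open>Normalizing both factors divides by a multiple of \<open>s j\<close>, which cancels the
  coefficient and gives both terms the same weight. In the sum the upper-left entries a e and - a e
  cancel, and the other entries are divisible by s_0 + s_1.\<close>

lemma schmidt_amplitudes:
  "(\<Sum>j = 0..1. s j *\<^sub>R ((u j /\<^sub>R norm (u j)) \<otimes>\<^sub>q (v j /\<^sub>R norm (v j)))) =
    amplitudes 0 (a * f / K\<^sup>2) (b * e / K\<^sup>2) (b * f * (s 0 - s 1) / K\<^sup>2)"
proof -
  let ?S = "s 0 + s 1"
  have S: "?S > 0" using s by simp
  have t: "s j *\<^sub>R ((u j /\<^sub>R norm (u j)) \<otimes>\<^sub>q (v j /\<^sub>R norm (v j))) =
      (1 / (K\<^sup>2 * ?S)) *\<^sub>R (u j \<otimes>\<^sub>q v j)" if "j \<in> {0..1}" for j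
  proof -
    have "s j *\<^sub>R ((u j /\<^sub>R norm (u j)) \<otimes>\<^sub>q (v j /\<^sub>R norm (v j))) =
        (s j / (norm (u j))\<^sup>2) *\<^sub>R (u j \<otimes>\<^sub>q v j)"
      unfolding schmidt_norm(2)[OF that]
      by (simp add: vec_eq_iff tensor_def power2_eq_square divide_inverse)
    also have "s j / (norm (u j))\<^sup>2 = 1 / (K\<^sup>2 * ?S)"
      using that s K S schmidt_norm(1)[OF that] by (auto simp: divide_simps le_Suc_eq)
    finally show ?thesis .
  qed
  have S0: "complex_of_real (s 0) + complex_of_real (s 1) \<noteq> 0" "complex_of_real K \<noteq> 0"
    using S K by (simp_all del: of_real_add flip: of_real_add)
  have "a * (f * s 0) + a * (f * s 1) = a * f * (complex_of_real (s 0) + complex_of_real (s 1))"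
    "b * s 0 * e + b * s 1 * e = b * e * (complex_of_real (s 0) + complex_of_real (s 1))"
    "b * s 0 * (f * s 0) - b * s 1 * (f * s 1) =
      b * f * (s 0 - s 1) * (complex_of_real (s 0) + complex_of_real (s 1))"
    by (simp_all add: algebra_simps)
  moreover have "(1 / (K\<^sup>2 * ?S)) *\<^sub>R (x * (complex_of_real (s 0) + complex_of_real (s 1))) = x / K\<^sup>2" for x
    using S0 by (simp add: scaleR_conv_of_real)
  moreover have "(\<Sum>j = 0..1. s j *\<^sub>R ((u j /\<^sub>R norm (u j)) \<otimes>\<^sub>q (v j /\<^sub>R norm (v j)))) =
      (1 / (K\<^sup>2 * ?S)) *\<^sub>R (u 0 \<otimes>\<^sub>q v 0 + u 1 \<otimes>\<^sub>q v 1)"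
    using t[of 0] t[of 1] by (simp add: scaleR_add_right)
  ultimately show ?thesis
    by (simp add: two_qubits_eq_iff tensor_eq_amplitudes u v vector_2 flip: scaleR_add_right
        del: One_nat_def)
qed

text \<open>The assumption on \<open>a\<close> and \<open>e\<close> also gives orthogonality: the
  inner products are, up to sign, K^2 s_0 s_1 - K^2 s_0 s_1. The sum has norm one since 2 s_0 s_1 +
  (s_0 - s_1)^2 = s_0^2 + s_1^2.\<close>

lemma schmidt_decomposition_sum:
  "schmidt_decomposition (\<Sum>j = 0..1. s j *\<^sub>R ((u j /\<^sub>R norm (u j)) \<otimes>\<^sub>q (v j /\<^sub>R norm (v j))))
    {0..1} s (\<lambda>j. u j /\<^sub>R norm (u j)) (\<lambda>j. v j /\<^sub>R norm (v j))"
proof -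
  have K0: "K \<noteq> 0" using K by simp
  have "cmod (a * f / K\<^sup>2) ^ 2 = s 0 * s 1" "cmod (b * e / K\<^sup>2) ^ 2 = s 0 * s 1"
    using K0 K ae by (simp_all add: norm_mult norm_divide norm_power power_mult_distrib
        power_divide) (simp_all add: power2_eq_square power4_eq_xxxx divide_simps)
  moreover have "cmod (b * f * (s 0 - s 1) / K\<^sup>2) = \<bar>s 0 - s 1\<bar>"
    using K0 K by (simp add: norm_mult norm_divide norm_power power2_eq_square
        flip: of_real_diff)
  moreover have "s 0 * s 1 + s 0 * s 1 + (s 0 - s 1)\<^sup>2 = 1"
    using s by (simp add: power2_eq_square algebra_simps)
  ultimately have st: "state (amplitudes 0 (a * f / K\<^sup>2) (b * e / K\<^sup>2) (b * f * (s 0 - s 1) / K\<^sup>2))"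
    unfolding state_amplitudes by simp
  have cnj_self: "cnj x * x = complex_of_real ((cmod x)\<^sup>2)" for x
    by (simp add: complex_norm_square mult.commute del: of_real_power)
  have au: "cnj a * a = complex_of_real (s 0 * s 1 * K\<^sup>2)"
    "cnj e * e = complex_of_real (s 0 * s 1 * K\<^sup>2)"
    "cnj b * b = complex_of_real (K\<^sup>2)" "cnj f * f = complex_of_real (K\<^sup>2)"
    unfolding cnj_self ae K by simp_all
  have o: "hinner (u 0) (u 1) = 0" "hinner (v 0) (v 1) = 0"
    using au by (simp_all add: hinner_def sum_2 u v vector_2 algebra_simps del: One_nat_def)
  hence o': "hinner (u 1) (u 0) = 0" "hinner (v 1) (v 0) = 0"
    by (metis hinner_commute complex_cnj_zero)+
  have n: "hinner (u j /\<^sub>R norm (u j)) (u j /\<^sub>R norm (u j)) = 1"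
    "hinner (v j /\<^sub>R norm (v j)) (v j /\<^sub>R norm (v j)) = 1" if "j \<in> {0..1}" for j
    using schmidt_norm(2,3)[OF that] by (simp_all add: hinner_self)
  have I: "{0..1} = {0, 1 :: nat}"
    by auto
  have "orthonormal_family {0..1} (\<lambda>j. u j /\<^sub>R norm (u j))"
    "orthonormal_family {0..1} (\<lambda>j. v j /\<^sub>R norm (v j))"
    unfolding orthonormal_family_def I using n[of 0] n[of 1] o o'
    by (simp_all add: hinner_scaleR del: One_nat_def)
  moreover have "\<forall>j\<in>{0..1}. s j \<ge> 0"
    using s unfolding I by auto
  ultimately show ?thesis
    unfolding schmidt_decomposition_def using st schmidt_amplitudes by auto
qed

end

section \<open>The Schmidt coefficients: products and differences\<close>

lemma xi_facts:
  assumes "0 < cmod c" "cmod c < 1 / sqrt 2"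
  shows "0 < xi c 1" "xi c 1 \<le> xi c 0" "(xi c 0)\<^sup>2 + (xi c 1)\<^sup>2 = 1" "xi c 0 * xi c 1 = (cmod c)\<^sup>2"
    "xi c 0 - xi c 1 = sqrt (1 - 2 * (cmod c)\<^sup>2)"
proof -
  define m where "m = (cmod c)\<^sup>2"
  have "m < (1 / sqrt 2)\<^sup>2"
    unfolding m_def using assms by (intro power_strict_mono) auto
  hence m: "0 < m" "m < 1 / 2"
    using assms by (auto simp: m_def power_divide)
  have m4: "cmod c ^ 4 = m\<^sup>2"
    by (simp add: m_def power_mult[symmetric])
  define q where "q = sqrt (1 - 4 * m\<^sup>2)"
  \<comment> \<open>The bound on \<open>c\<close> keeps the radicand 1 - 4 m^2 positive, and
    \<open>0 < m\<close> gives \<open>q < 1\<close>, hence a positive smaller coefficient.\<close>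
  have "m\<^sup>2 < (1 / 2)\<^sup>2"
    using m by (intro power_strict_mono) auto
  hence m2: "0 < m\<^sup>2" "4 * m\<^sup>2 < 1"
    using m by (auto simp: power_divide)
  have q2: "q\<^sup>2 = 1 - 4 * m\<^sup>2"
    using m2 by (simp add: q_def)
  have q: "0 \<le> q" "q < 1"
    using m2 by (auto simp: q_def)
  have xi: "xi c 0 = sqrt ((1 + q) / 2)" "xi c 1 = sqrt ((1 - q) / 2)"
    by (simp_all add: xi_def m4 q_def)
  show "0 < xi c 1" and le: "xi c 1 \<le> xi c 0" and sq: "(xi c 0)\<^sup>2 + (xi c 1)\<^sup>2 = 1"
    using q by (auto simp: xi field_simps simp del: One_nat_def)
  have "(1 + q) / 2 * ((1 - q) / 2) = m\<^sup>2"
    using q2 by (simp add: power2_eq_square field_simps)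
  hence pr: "xi c 0 * xi c 1 = m"
    unfolding xi real_sqrt_mult[symmetric] using m by simp
  thus "xi c 0 * xi c 1 = (cmod c)\<^sup>2"
    by (simp add: m_def)
  \<comment> \<open>The difference, which becomes the modulus of the lower-right amplitude, follows
    from the sum of squares and the product; the ordering of the coefficients fixes its
    sign.\<close>
  have "(xi c 0 - xi c 1)\<^sup>2 = 1 - 2 * m"
    using sq pr by (simp add: power2_diff)
  thus "xi c 0 - xi c 1 = sqrt (1 - 2 * (cmod c)\<^sup>2)"
    using le by (metis diff_ge_0_iff_ge m_def real_sqrt_unique)
qed

lemma upsilon_facts:
  assumes "0 < cmod c" "cmod c < 1 / sqrt 2"
  shows "0 < upsilon c 1" "upsilon c 1 \<le> upsilon c 0" "(upsilon c 0)\<^sup>2 + (upsilon c 1)\<^sup>2 = 1"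
    "upsilon c 0 * upsilon c 1 = (1 - 2 * (cmod c)\<^sup>2) / 2"
    "upsilon c 0 - upsilon c 1 = sqrt 2 * cmod c"
proof -
  define m where "m = (cmod c)\<^sup>2"
  have "m < (1 / sqrt 2)\<^sup>2"
    unfolding m_def using assms by (intro power_strict_mono) auto
  hence m: "0 < m" "m < 1 / 2"
    using assms by (auto simp: m_def power_divide)
  define q where "q = 2 * cmod c * sqrt (1 - m)"
  have q2: "q\<^sup>2 = 4 * m * (1 - m)"
    using m by (simp add: q_def power_mult_distrib m_def)
  \<comment> \<open>This perfect square removes the root from the product of the coefficients, and
    its positivity yields \<open>q < 1\<close>.\<close>
  have "1 - q\<^sup>2 = (1 - 2 * m)\<^sup>2"
    unfolding q2 by (simp add: power2_eq_square algebra_simps)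
  moreover have "(1 - 2 * m)\<^sup>2 > 0"
    using m by simp
  ultimately have "q\<^sup>2 < 1"
    by linarith
  hence q: "0 \<le> q" "q < 1"
    using m power2_less_imp_less[of q 1] by (simp_all add: q_def)
  have up: "upsilon c 0 = sqrt ((1 + q) / 2)" "upsilon c 1 = sqrt ((1 - q) / 2)"
    by (simp_all add: upsilon_def m_def q_def)
  show "0 < upsilon c 1" and le: "upsilon c 1 \<le> upsilon c 0"
    and sq: "(upsilon c 0)\<^sup>2 + (upsilon c 1)\<^sup>2 = 1"
    using q by (auto simp: up field_simps simp del: One_nat_def)
  have "(1 + q) / 2 * ((1 - q) / 2) = (1 - q\<^sup>2) / 4"
    by (simp add: power2_eq_square field_simps)
  also have "\<dots> = ((1 - 2 * m) / 2)\<^sup>2"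
    by (simp add: \<open>1 - q\<^sup>2 = (1 - 2 * m)\<^sup>2\<close> power_divide)
  finally have "(1 + q) / 2 * ((1 - q) / 2) = ((1 - 2 * m) / 2)\<^sup>2" .
  moreover have "sqrt (((1 - 2 * m) / 2)\<^sup>2) = (1 - 2 * m) / 2"
    using m by (simp only: real_sqrt_abs) simp
  ultimately have pr: "upsilon c 0 * upsilon c 1 = (1 - 2 * m) / 2"
    unfolding up real_sqrt_mult[symmetric] by simp
  thus "upsilon c 0 * upsilon c 1 = (1 - 2 * (cmod c)\<^sup>2) / 2"
    by (simp add: m_def)
  have "(upsilon c 0 - upsilon c 1)\<^sup>2 = 2 * m"
    using sq pr by (simp add: power2_diff field_simps)
  hence "(upsilon c 0 - upsilon c 1)\<^sup>2 = (sqrt 2 * cmod c)\<^sup>2"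
    by (simp add: m_def power_mult_distrib)
  thus "upsilon c 0 - upsilon c 1 = sqrt 2 * cmod c"
    by (rule power2_eq_imp_eq) (use le in simp_all)
qed

section \<open>The two parametrized families as coefficient matrices\<close>

lemma pmEe_schmidt:
  assumes c: "0 < cmod c" "cmod c < 1 / sqrt 2"
  shows "pmEe \<theta> \<theta>' \<theta>'' c =
      amplitudes 0 c (- cis (\<theta>' - \<theta>) * c) (cis \<theta>'' * sqrt (1 - 2 * (cmod c)\<^sup>2))" (is ?A)
    and "schmidt_decomposition (pmEe \<theta> \<theta>' \<theta>'' c) {0..1 :: nat} (xi c)
          (\<lambda>j. x_vec \<theta>'' c j /\<^sub>R norm (x_vec \<theta>'' c j))
          (\<lambda>j. vcnj (y_vec \<theta> \<theta>' \<theta>'' c j) /\<^sub>R norm (y_vec \<theta> \<theta>' \<theta>'' c j))" (is ?B)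
proof -
  note xi = xi_facts[OF c]
  let ?e = "- cis (- (\<theta> - \<theta>' + \<theta>'')) * c"
  have pos: "0 < xi c 0" using xi(1,2) by simp
  \<comment> \<open>The template is used with \<open>K = 1\<close>, \<open>a = c\<close>,
    \<open>b = cis \<theta>''\<close> and \<open>f = 1\<close>; its assumption on \<open>a\<close>
    and \<open>e\<close> is then the product formula for \<open>xi\<close>.\<close>
  have n: "(cmod c)\<^sup>2 = xi c 0 * xi c 1 * 1\<^sup>2" "(cmod ?e)\<^sup>2 = xi c 0 * xi c 1 * 1\<^sup>2"
    by (simp_all add: xi(4) norm_mult del: One_nat_def)
  have f: "0 < (1 :: real)" "cmod (cis \<theta>'') = 1" "cmod 1 = 1"
    by simp_all
  have v: "vcnj (y_vec \<theta> \<theta>' \<theta>'' c j) = vector [?e, (- 1) ^ j * 1 * complex_of_real (xi c j)]" for j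
    by (simp add: y_vec_def)
  note args = f pos xi(1,3) n x_vec_def v
  \<comment> \<open>The phase \<open>\<theta>''\<close> cancels in the lower-left entry, leaving the
    ratio to the upper-right entry that orthogonality to \<open>pMee\<close> demands.\<close>
  have "cis \<theta>'' * ?e = - cis (\<theta>' - \<theta>) * c"
    by (simp add: cis_mult mult.assoc[symmetric])
  thus ?A
    unfolding schmidt_amplitudes[OF args, unfolded norm_vcnj, folded pmEe_def] xi(5)
    by (auto simp: amplitudes_eq_iff)
  show ?B
    using schmidt_decomposition_sum[OF args] unfolding pmEe_def by simp
qed

text \<open>Here the template is used with K = |c|, \<open>b = - cnj c\<close> and f = |c|. The root
  \<open>r\<close> equals sqrt(\<upsilon>_0 \<upsilon>_1), and \<upsilon>_0 - \<upsilon>_1 = sqrt 2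
  |c| produces the lower-right entry.\<close>

lemma pmeE_schmidt:
  assumes c: "0 < cmod c" "cmod c < 1 / sqrt 2"
  defines "r \<equiv> complex_of_real (sqrt ((1 - 2 * (cmod c)\<^sup>2) / 2))"
  shows "pmeE \<theta> \<theta>' \<theta>'' c =
      amplitudes 0 (cis (- \<theta>'') * r) (- cis (\<theta>' - \<theta>) * (cis (- \<theta>'') * r)) (- sqrt 2 * cnj c)" (is ?A)
    and "schmidt_decomposition (pmeE \<theta> \<theta>' \<theta>'' c) {0..1 :: nat} (upsilon c)
          (\<lambda>j. z_vec \<theta>'' c j /\<^sub>R norm (z_vec \<theta>'' c j))
          (\<lambda>j. vcnj (w_vec \<theta> \<theta>' \<theta>'' c j) /\<^sub>R norm (w_vec \<theta> \<theta>' \<theta>'' c j))" (is ?B)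
proof -
  note up = upsilon_facts[OF c]
  have pos: "0 < upsilon c 0" using up(1,2) by simp
  have r: "complex_of_real (sqrt (upsilon c 0 * upsilon c 1)) = r"
    by (simp add: r_def up(4) del: One_nat_def)
  have rr: "(cmod r)\<^sup>2 = upsilon c 0 * upsilon c 1"
    using pos up(1) by (simp flip: r)
  let ?a = "cis (- \<theta>'') * (r * cmod c)"
  let ?e = "cis (- (\<theta> - \<theta>' + \<theta>'')) * r * c"
  have n: "(cmod ?a)\<^sup>2 = upsilon c 0 * upsilon c 1 * (cmod c)\<^sup>2"
    "(cmod ?e)\<^sup>2 = upsilon c 0 * upsilon c 1 * (cmod c)\<^sup>2"
    by (simp_all add: rr norm_mult power_mult_distrib)
  have f: "cmod (- cnj c) = cmod c" "cmod (complex_of_real (cmod c)) = cmod c"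
    by simp_all
  have u: "z_vec \<theta>'' c j = vector [(- 1) ^ j * ?a, - cnj c * complex_of_real (upsilon c j)]" for j
    by (simp add: z_vec_def mult.assoc flip: r)
  have v: "vcnj (w_vec \<theta> \<theta>' \<theta>'' c j) = vector [?e, (- 1) ^ j * complex_of_real (cmod c) * complex_of_real (upsilon c j)]" for j
    by (simp add: w_vec_def mult.assoc flip: r)
  note args = c(1) f pos up(1,3) n u v
  have c0: "complex_of_real (cmod c) \<noteq> 0" using c by auto
  have cc: "(complex_of_real (cmod c))\<^sup>2 = c * cnj c"
    by (simp add: complex_norm_square flip: of_real_power)
  have "cis (- (\<theta> - \<theta>' + \<theta>'')) = cis (\<theta>' - \<theta>) * cis (- \<theta>'')"
    by (simp add: cis_mult)
  hence "- cnj c * ?e / (cmod c)\<^sup>2 = - cis (\<theta>' - \<theta>) * (cis (- \<theta>'') * r)"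
    using c0 cc by (simp add: field_simps)
  moreover have "?a * cmod c / (cmod c)\<^sup>2 = cis (- \<theta>'') * r"
    using c0 by (simp add: field_simps power2_eq_square)
  moreover have "- cnj c * cmod c * complex_of_real (upsilon c 0 - upsilon c 1) / (cmod c)\<^sup>2 = - sqrt 2 * cnj c"
    using c0 unfolding up(5) by (simp add: field_simps power2_eq_square)
  ultimately show ?A
    unfolding schmidt_amplitudes[OF args, unfolded norm_vcnj, folded pmeE_def] by simp
  show ?B
    using schmidt_decomposition_sum[OF args] unfolding pmeE_def by simp
qed

subsection \<open>Completing the two given states\<close>

text \<open>The first condition removes the 00 amplitude. The second is a linear equation in
  \<open>b\<close> and \<open>g\<close>, solved after factoring out the nonzero phase
  \<open>cis (- \<theta>')\<close>.\<close>

lemma orthogonal_Pmee_pMee: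
  "hinner Pmee (amplitudes a b g d) = 0 \<and> hinner (pMee \<theta> \<theta>') (amplitudes a b g d) = 0 \<longleftrightarrow>
    a = 0 \<and> g = - cis (\<theta>' - \<theta>) * b"
proof -
  have "hinner (pMee \<theta> \<theta>') (amplitudes a b g d) = (cis (- \<theta>) * b + cis (- \<theta>') * g) / sqrt 2"
    by (simp add: pMee_eq_amplitudes hinner_amplitudes cis_cnj add_divide_distrib)
  also have "\<dots> = cis (- \<theta>') * (cis (\<theta>' - \<theta>) * b + g) / sqrt 2"
    by (simp add: distrib_left mult.assoc[symmetric] cis_mult)
  finally have "hinner (pMee \<theta> \<theta>') (amplitudes a b g d) = 0 \<longleftrightarrow> g = - cis (\<theta>' - \<theta>) * b"
    by (simp add: add_eq_0_iff)
  thus ?thesis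
    by (simp add: Pmee_eq_amplitudes hinner_amplitudes)
qed

text \<open>The two given states are already orthonormal, and four orthonormal vectors span a space
  of dimension four, so only the inner products involving \<psi> and \<phi> remain.\<close>

lemma orthonormal_basis_completion_iff:
  fixes \<psi> \<phi> :: two_qubits
  shows "orthonormal_basis [Pmee, pMee \<theta> \<theta>', \<psi>, \<phi>] \<longleftrightarrow>
    state \<psi> \<and> state \<phi> \<and> hinner \<psi> \<phi> = 0 \<and>
    hinner Pmee \<psi> = 0 \<and> hinner (pMee \<theta> \<theta>') \<psi> = 0 \<and>
    hinner Pmee \<phi> = 0 \<and> hinner (pMee \<theta> \<theta>') \<phi> = 0" (is "_ \<longleftrightarrow> ?R")
proof -
  let ?vs = "[Pmee, pMee \<theta> \<theta>', \<psi>, \<phi>]"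
  have "state Pmee" "state (pMee \<theta> \<theta>')" "hinner Pmee (pMee \<theta> \<theta>') = 0"
    by (simp_all add: Pmee_eq_amplitudes pMee_eq_amplitudes state_amplitudes hinner_amplitudes norm_divide
        power_divide)
  hence "orthonormal_family {..<length ?vs} (\<lambda>k. ?vs ! k) \<longleftrightarrow> ?R"
    unfolding orthonormal_family_def state_iff_hinner
    by (simp add: lessThan_Suc numeral_eq_Suc) (metis hinner_commute complex_cnj_zero)
  thus ?thesis
    using orthonormal_family_imp_basis[of ?vs] by (auto simp: orthonormal_basis_def)
qed

text \<open>Taking moduli in the orthogonality relation and eliminating \<open>d\<close> and
  \<open>d'\<close> gives 4 |b|^2 |b'|^2 = (1 - 2 |b|^2) (1 - 2 |b'|^2). The mixed terms cancel,
  leaving 2 |b|^2 + 2 |b'|^2 = 1.\<close>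

lemma norm_orthogonal_companion:
  assumes b: "2 * (cmod b)\<^sup>2 + (cmod d)\<^sup>2 = 1" and b': "2 * (cmod b')\<^sup>2 + (cmod d')\<^sup>2 = 1"
    and o: "2 * (cnj b * b') + cnj d * d' = 0"
  shows "(cmod d')\<^sup>2 = 2 * (cmod b)\<^sup>2"
proof -
  have "cmod (2 * (cnj b * b')) = cmod (cnj d * d')"
    using o by (metis add_eq_0_iff norm_minus_cancel)
  hence "(2 * (cmod b * cmod b'))\<^sup>2 = (cmod d * cmod d')\<^sup>2"
    by (simp add: norm_mult)
  moreover have "(cmod d)\<^sup>2 = 1 - 2 * (cmod b)\<^sup>2" "(cmod d')\<^sup>2 = 1 - 2 * (cmod b')\<^sup>2"
    using b b' by simp_all
  ultimately have "4 * (cmod b)\<^sup>2 * (cmod b')\<^sup>2 = (1 - 2 * (cmod b)\<^sup>2) * (1 - 2 * (cmod b')\<^sup>2)"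
    by (simp add: power_mult_distrib)
  thus ?thesis
    using b' by (simp add: algebra_simps)
qed

section \<open>The characterization of the completing pairs\<close>

theorem theorem19:
  fixes \<theta> \<theta>' :: real
  shows
    "(\<forall>(\<psi> :: two_qubits) (\<phi> :: two_qubits).
        entangled \<psi> \<and> entangled \<phi> \<and> orthonormal_basis [Pmee, pMee \<theta> \<theta>', \<psi>, \<phi>] \<longleftrightarrow>
        (\<exists>(\<theta>'' :: real) (c :: complex). 0 < cmod c \<and> cmod c < 1 / sqrt 2 \<and>
           eq_up_to_phase \<psi> (pmEe \<theta> \<theta>' \<theta>'' c) \<and> eq_up_to_phase \<phi> (pmeE \<theta> \<theta>' \<theta>'' c))) \<and>
     (\<forall>(\<theta>'' :: real) (c :: complex). 0 < cmod c \<and> cmod c < 1 / sqrt 2 \<longrightarrow>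
        schmidt_decomposition (pmEe \<theta> \<theta>' \<theta>'' c) {0..1 :: nat} (xi c)
          (\<lambda>j. x_vec \<theta>'' c j /\<^sub>R norm (x_vec \<theta>'' c j))
          (\<lambda>j. vcnj (y_vec \<theta> \<theta>' \<theta>'' c j) /\<^sub>R norm (y_vec \<theta> \<theta>' \<theta>'' c j)) \<and>
        schmidt_decomposition (pmeE \<theta> \<theta>' \<theta>'' c) {0..1 :: nat} (upsilon c)
          (\<lambda>j. z_vec \<theta>'' c j /\<^sub>R norm (z_vec \<theta>'' c j))
          (\<lambda>j. vcnj (w_vec \<theta> \<theta>' \<theta>'' c j) /\<^sub>R norm (w_vec \<theta> \<theta>' \<theta>'' c j)))"
proof (rule conjI; intro allI)
  fix \<psi> \<phi> :: two_qubits
  let ?k = "- cis (\<theta>' - \<theta>)"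
  show "entangled \<psi> \<and> entangled \<phi> \<and> orthonormal_basis [Pmee, pMee \<theta> \<theta>', \<psi>, \<phi>] \<longleftrightarrow>
      (\<exists>\<theta>'' c. 0 < cmod c \<and> cmod c < 1 / sqrt 2 \<and>
        eq_up_to_phase \<psi> (pmEe \<theta> \<theta>' \<theta>'' c) \<and> eq_up_to_phase \<phi> (pmeE \<theta> \<theta>' \<theta>'' c))"
  proof
    assume asm: "entangled \<psi> \<and> entangled \<phi> \<and> orthonormal_basis [Pmee, pMee \<theta> \<theta>', \<psi>, \<phi>]"
    obtain b d where \<psi>: "\<psi> = amplitudes 0 b (?k * b) d"
      using asm unfolding orthonormal_basis_completion_iff
      by (metis amplitudes_cases orthogonal_Pmee_pMee)
    obtain b' d' where \<phi>: "\<phi> = amplitudes 0 b' (?k * b') d'"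
      using asm unfolding orthonormal_basis_completion_iff
      by (metis amplitudes_cases orthogonal_Pmee_pMee)
    have b0: "b \<noteq> 0" "b' \<noteq> 0"
      using asm unfolding \<psi> \<phi> entangled_amplitudes by auto
    have n: "2 * (cmod b)\<^sup>2 + (cmod d)\<^sup>2 = 1" "2 * (cmod b')\<^sup>2 + (cmod d')\<^sup>2 = 1"
      using asm unfolding \<psi> \<phi> entangled_amplitudes state_amplitudes by (auto simp: norm_mult)
    have "cnj ?k * ?k = 1"
      by (simp add: cis_cnj cis_mult)
    hence "hinner \<psi> \<phi> = 2 * (cnj b * b') + cnj d * d'"
      unfolding \<psi> \<phi> hinner_amplitudes by (simp add: algebra_simps)
    hence o: "2 * (cnj b * b') + cnj d * d' = 0"
      using asm unfolding orthonormal_basis_completion_iff by simp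
    \<comment> \<open>Entanglement of the companion enters here: \<open>d = 0\<close> would force
      \<open>b = 0\<close> or \<open>b' = 0\<close>. This gives the strict upper bound on the
      modulus of \<open>b\<close>.\<close>
    have d0: "d \<noteq> 0"
      using o b0 by auto
    have "(cmod b)\<^sup>2 < (1 / sqrt 2)\<^sup>2"
    proof -
      have "(cmod d)\<^sup>2 > 0"
        using d0 by simp
      hence "(cmod b)\<^sup>2 < 1 / 2"
        using n(1) by linarith
      thus ?thesis
        by (simp add: power_divide)
    qed
    hence c: "0 < cmod b" "cmod b < 1 / sqrt 2"
      using b0 by (auto intro: power2_less_imp_less)
    have sd: "sqrt (1 - 2 * (cmod b)\<^sup>2) = cmod d"
      using n(1) by (intro real_sqrt_unique) auto
    have dd: "cis (Arg d) * cmod d = d"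
      using rcis_cmod_Arg[of d] by (simp add: rcis_def mult.commute)
    have dd': "cis (- Arg d) * cmod d = cnj d"
      using arg_cong[OF dd, of cnj] by (simp add: cis_cnj)
    have "\<psi> = pmEe \<theta> \<theta>' (Arg d) b"
      unfolding pmEe_schmidt[OF c] sd dd \<psi> ..
    hence 1: "eq_up_to_phase \<psi> (pmEe \<theta> \<theta>' (Arg d) b)"
      unfolding eq_up_to_phase_def by (intro exI[of _ 1]) (simp add: vector_smult_lid)
    \<comment> \<open>The global phase of the second state, read off from the lower-right entry; the
      norm of the companion makes it unimodular.\<close>
    define e where "e = - d' / (sqrt 2 * cnj b)"
    have "(cmod e)\<^sup>2 = 1"
      using norm_orthogonal_companion[OF n o] b0
      by (simp add: e_def norm_divide norm_mult power_divide power_mult_distrib)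
    hence e1: "cmod e = 1"
      using norm_ge_zero[of e] by (auto simp: power2_eq_1_iff simp del: norm_ge_zero)
    have r: "cis (- Arg d) * complex_of_real (sqrt ((1 - 2 * (cmod b)\<^sup>2) / 2)) = cnj d / sqrt 2"
      by (simp add: real_sqrt_divide sd dd'[symmetric])
    have s2: "complex_of_real (sqrt 2) * complex_of_real (sqrt 2) = 2"
      by (simp flip: of_real_mult)
    \<comment> \<open>Orthogonality determines \<open>b'\<close> from \<open>d'\<close>, so the same
      phase \<open>e\<close> also accounts for the upper-right entry.\<close>
    have "b' = - (cnj d * d') / (2 * cnj b)"
      using o b0 by (simp add: field_simps add_eq_0_iff)
    also have "\<dots> = e * (cnj d / sqrt 2)"
      unfolding e_def s2[symmetric] by (simp add: mult_ac)
    finally have be: "b' = e * (cnj d / sqrt 2)" .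
    have de: "d' = e * (- sqrt 2 * cnj b)"
      using b0 by (simp add: e_def)
    have "\<phi> = e *s pmeE \<theta> \<theta>' (Arg d) b"
      unfolding pmeE_schmidt[OF c] r \<phi> amplitudes_smult amplitudes_eq_iff using be de
      by (metis mult.left_commute mult_zero_right)
    hence "eq_up_to_phase \<phi> (pmeE \<theta> \<theta>' (Arg d) b)"
      unfolding eq_up_to_phase_def using e1 by blast
    with 1 c show "\<exists>\<theta>'' c. 0 < cmod c \<and> cmod c < 1 / sqrt 2 \<and>
        eq_up_to_phase \<psi> (pmEe \<theta> \<theta>' \<theta>'' c) \<and> eq_up_to_phase \<phi> (pmeE \<theta> \<theta>' \<theta>'' c)"
      by blast
  next
    assume "\<exists>\<theta>'' c. 0 < cmod c \<and> cmod c < 1 / sqrt 2 \<and>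
        eq_up_to_phase \<psi> (pmEe \<theta> \<theta>' \<theta>'' c) \<and> eq_up_to_phase \<phi> (pmeE \<theta> \<theta>' \<theta>'' c)"
    then obtain \<theta>'' c a1 a2 where c: "0 < cmod c" "cmod c < 1 / sqrt 2"
      and a: "cmod a1 = 1" "cmod a2 = 1"
      and eq: "\<psi> = a1 *s pmEe \<theta> \<theta>' \<theta>'' c" "\<phi> = a2 *s pmeE \<theta> \<theta>' \<theta>'' c"
      unfolding eq_up_to_phase_def by blast
    define m where "m = complex_of_real (sqrt (1 - 2 * (cmod c)\<^sup>2))"
    have "(cmod c)\<^sup>2 < (1 / sqrt 2)\<^sup>2"
      using c by (intro power_strict_mono) auto
    hence m0: "m \<noteq> 0" "1 - 2 * (cmod c)\<^sup>2 > 0"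
      by (auto simp: m_def power_divide)
    have s2: "complex_of_real (sqrt 2) * complex_of_real (sqrt 2) = 2"
      by (simp flip: of_real_mult)
    define b where "b = cis (- \<theta>'') * (m / sqrt 2)"
    have e: "pmEe \<theta> \<theta>' \<theta>'' c = amplitudes 0 c (?k * c) (cis \<theta>'' * m)"
      "pmeE \<theta> \<theta>' \<theta>'' c = amplitudes 0 b (?k * b) (- sqrt 2 * cnj c)"
      unfolding pmEe_schmidt[OF c] pmeE_schmidt[OF c] m_def b_def by (simp_all add: real_sqrt_divide)
    have st: "state (pmEe \<theta> \<theta>' \<theta>'' c)" "state (pmeE \<theta> \<theta>' \<theta>'' c)"
      using pmEe_schmidt(2)[OF c] pmeE_schmidt(2)[OF c]
      unfolding schmidt_decomposition_def by blast+
    have st': "state \<psi>" "state \<phi>"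
      using st a unfolding eq state_iff_hinner hinner_mult
      by (simp_all add: mult.commute flip: complex_norm_square)
    \<comment> \<open>The strict bound on \<open>c\<close> makes \<open>m\<close>, and with it
      \<open>b\<close>, nonzero, which is what entanglement of the second state requires.\<close>
    have ab: "a1 \<noteq> 0" "a2 \<noteq> 0" "b \<noteq> 0" "c \<noteq> 0"
      using a c m0 by (auto simp: b_def)
    \<comment> \<open>Multiplying by a phase preserves the ratio \<open>?k\<close> of the
      off-diagonal entries, so the criteria for entanglement and orthogonality apply
      directly.\<close>
    have \<psi>: "\<psi> = amplitudes 0 (a1 * c) (?k * (a1 * c)) (a1 * (cis \<theta>'' * m))"
      and \<phi>: "\<phi> = amplitudes 0 (a2 * b) (?k * (a2 * b)) (a2 * (- sqrt 2 * cnj c))"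
      unfolding eq e amplitudes_smult amplitudes_eq_iff by simp_all
    have ent: "entangled \<psi>" "entangled \<phi>"
      using st' ab unfolding \<psi> \<phi> entangled_amplitudes by simp_all
    have "cnj ?k * ?k = 1"
      by (simp add: cis_cnj cis_mult)
    hence "hinner (pmEe \<theta> \<theta>' \<theta>'' c) (pmeE \<theta> \<theta>' \<theta>'' c) =
        2 * (cnj c * b) + cnj (cis \<theta>'' * m) * (- sqrt 2 * cnj c)"
      unfolding e hinner_amplitudes by (simp add: algebra_simps)
    \<comment> \<open>Writing 2 as a product of two square roots makes both terms multiples of sqrt
      2 with opposite signs.\<close>
    also have "\<dots> = 0"
      unfolding b_def s2[symmetric] by (simp add: m_def cis_cnj)
    finally have "hinner \<psi> \<phi> = 0"
      unfolding eq hinner_mult by simp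
    moreover have "hinner Pmee \<psi> = 0 \<and> hinner (pMee \<theta> \<theta>') \<psi> = 0"
      "hinner Pmee \<phi> = 0 \<and> hinner (pMee \<theta> \<theta>') \<phi> = 0"
      unfolding \<psi> \<phi> orthogonal_Pmee_pMee by simp_all
    ultimately show "entangled \<psi> \<and> entangled \<phi> \<and> orthonormal_basis [Pmee, pMee \<theta> \<theta>', \<psi>, \<phi>]"
      using ent st' unfolding orthonormal_basis_completion_iff by simp
  qed
qed (intro impI conjI pmEe_schmidt(2) pmeE_schmidt(2); elim conjE; assumption)

end
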